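(* Let $\mathcal I$ be an IOSA and let $b\in\mathcal A^{\mathsf u}\cap\mathcal A^{\mathsf o}$ be enabled in some potentially reachable state of $\mathcal I$ (i.e., $b\in\mathrm{uen}(s)$ for some potentially reachable $s$). Then either there is a set $B$ with $b\in B$ that is initial or spontaneously enabled by some action $a\in\mathcal A\setminus\mathcal A^{\mathsf u}$, or $b$ is triggered by some action $a\in\mathcal A^{\mathsf u}$.
   Context: An IOSA is a tuple $\mathcal I=(\mathcal S,\mathcal A,\mathcal C,\rightarrow,C_0,s_0)$: denumerable states $\mathcal S$; denumerable actions $\mathcal A$ partitioned into inputs $\mathcal A^{\mathsf i}$ and outputs $\mathcal A^{\mathsf o}$, with urgent subset $\mathcal A^{\mathsf u}$ and silent action $\tau\in\mathcal A^{\mathsf u}\cap\mathcal A^{\mathsf o}$; finite clock set $\mathcal C$ (each clock with a continuous probability measure on $\mathbb R$ concentrated on $\mathbb R_{>0}$); transitions $s\xrightarrow{C,a,C'}s'$ with $C,C'\subseteq\mathcal C$; $C_0\subseteq\mathcal C$; initial state $s_0$; satisfying: (a) $a\in\mathcal A^{\mathsf i}\cup\mathcal A^{\mathsf u}$ implies $C=\emptyset$; (b) $a\in\mathcal A^{\mathsf o}\setminus\mathcal A^{\mathsf u}$ implies $C$ singleton; (c) transitions from one state guarded by the same single clock coincide; (d) every input is enabled in every state; (e) inputs are deterministic; (f) there is $\mathrm{active}:\mathcal S\to2^{\mathcal C}$ with $\mathrm{active}(s_0)\subseteq C_0$, $\mathrm{enabling}(s)\subseteq\mathrm{active}(s)$,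 equality when $s$ is stable, and $\mathrm{active}(s)\subseteq(\mathrm{active}(t)\setminus C)\cup C'$ whenever $t\xrightarrow{C,a,C'}s$ (where $\mathrm{enabling}(s)$ is the set of clocks $y$ with $s\xrightarrow{\{y\},\cdot,\cdot}\cdot$). A state $s$ is stable if no $a\in\mathcal A^{\mathsf u}\cap\mathcal A^{\mathsf o}$ has $s\xrightarrow{\emptyset,a,\cdot}\cdot$. $\mathrm{uen}(s)=\{a\in\mathcal A^{\mathsf u}\mid s\xrightarrow{\_,a,\_}\_\}$ ($\_$ existentially quantified). A state $s$ is potentially reachable if there is a path $s_0\xrightarrow{\_,a_0,\_}s_1\cdots\xrightarrow{\_,a_{m-1},\_}s_m=s$ ($m\ge0$) from the initial state such that for all $i<m$, if $s_i\xrightarrow{\_,c,\_}\_$ for some $c\in\mathcal A^{\mathsf u}\cap\mathcal A^{\mathsf o}$ then $a_i\in\mathcal A^{\mathsf u}$. A set $B\subseteq\mathcal A^{\mathsf u}\cap\mathcal A^{\mathsf o}$ is initial if $B\subseteq\mathrm{uen}(s_0)$. $B$ is spontaneously enabled by $a\in\mathcal A\setminus\mathcal A^{\mathsf u}$ if $B=\emptyset$ or there are potentially reachable $s,s'$ with $s$ stable, $s\xrightarrow{\_,a,\_}s'$, $B\subseteq\mathrm{uen}(s')$. For $a\in\mathcal A^{\mathsf u}$, $b\in\mathcal A^{\mathsf u}\cap\mathcal A^{\mathsf o}$, $a$ triggers $b$ if there are potentially reachable $s_1,s_2,s_3$ with $s_1\xrightarrow{\_,a,\_}s_2\xrightarrow{\_,b,\_}s_3$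 and, if $a\ne b$, $b\notin\mathrm{uen}(s_1)$. *)

theory Defs
  imports "HOL-Probability.Probability"
begin

record ('s, 'a, 'c) iosa_struct =
  states :: "'s set"
  actions :: "'a set"
  inputs :: "'a set"
  outputs :: "'a set"
  urgent :: "'a set"
  silent :: 'a
  clocks :: "'c set"
  clock_measure :: "'c \<Rightarrow> real measure"
  trans_rel :: "('s \<times> 'c set \<times> 'a \<times> 'c set \<times> 's) set"
  init_clocks :: "'c set"
  init_state :: 's

definition urgent_outputs :: "('s, 'a, 'c) iosa_struct \<Rightarrow> 'a set" where
  "urgent_outputs I = urgent I \<inter> outputs I"

definition step :: "('s, 'a, 'c) iosa_struct \<Rightarrow> 's \<Rightarrow> 'a \<Rightarrow> 's \<Rightarrow> bool" where
  "step I s a s' \<longleftrightarrow> (\<exists>C C'. (s, C, a, C', s') \<in> trans_rel I)"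

definition stable :: "('s, 'a, 'c) iosa_struct \<Rightarrow> 's \<Rightarrow> bool" where
  "stable I s \<longleftrightarrow> \<not> (\<exists>a\<in>urgent_outputs I. \<exists>C' s'. (s, {}, a, C', s') \<in> trans_rel I)"

definition enabling :: "('s, 'a, 'c) iosa_struct \<Rightarrow> 's \<Rightarrow> 'c set" where
  "enabling I s = {y. \<exists>a C' s'. (s, {y}, a, C', s') \<in> trans_rel I}"

(* "Continuous" clock measures are read as atomless Borel probability measures, i.e. those
   with a continuous distribution function; no density is required.
   "Denumerable" is read as countable, possibly finite. *)
locale IOSA =
  fixes I :: "('s, 'a, 'c) iosa_struct"
  assumes countable_states: "countable (states I)"
    and countable_actions: "countable (actions I)"
    and actions_partition: "actions I = inputs I \<union> outputs I" "inputs I \<inter> outputs I = {}"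
    and urgent_subset: "urgent I \<subseteq> actions I"
    and silent_urgent_output: "silent I \<in> urgent I \<inter> outputs I"
    and finite_clocks: "finite (clocks I)"
    and clock_prob_space: "x \<in> clocks I \<Longrightarrow> prob_space (clock_measure I x)"
    and clock_borel: "x \<in> clocks I \<Longrightarrow> sets (clock_measure I x) = sets borel"
    and clock_continuous: "x \<in> clocks I \<Longrightarrow> measure (clock_measure I x) {t} = 0"
    and clock_positive: "x \<in> clocks I \<Longrightarrow> measure (clock_measure I x) {0<..} = 1"
    and trans_rel_subset:
      "trans_rel I \<subseteq> states I \<times> Pow (clocks I) \<times> actions I \<times> Pow (clocks I) \<times> states I"
    and init_clocks_subset: "init_clocks I \<subseteq> clocks I"
    and init_state_in: "init_state I \<in> states I"
    and input_urgent_unguarded: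
      "(s, C, a, C', s') \<in> trans_rel I \<Longrightarrow> a \<in> inputs I \<union> urgent I \<Longrightarrow> C = {}"
    and nonurgent_output_guard:
      "(s, C, a, C', s') \<in> trans_rel I \<Longrightarrow> a \<in> outputs I - urgent I \<Longrightarrow> is_singleton C"
    and clock_deterministic:
      "(s, {x}, a\<^sub>1, C\<^sub>1, s\<^sub>1) \<in> trans_rel I \<Longrightarrow> (s, {x}, a\<^sub>2, C\<^sub>2, s\<^sub>2) \<in> trans_rel I \<Longrightarrow>
        a\<^sub>1 = a\<^sub>2 \<and> C\<^sub>1 = C\<^sub>2 \<and> s\<^sub>1 = s\<^sub>2"
    and input_enabled:
      "s \<in> states I \<Longrightarrow> a \<in> inputs I \<Longrightarrow> \<exists>C' s'. (s, {}, a, C', s') \<in> trans_rel I"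
    and input_deterministic:
      "a \<in> inputs I \<Longrightarrow> (s, {}, a, C\<^sub>1, s\<^sub>1) \<in> trans_rel I \<Longrightarrow> (s, {}, a, C\<^sub>2, s\<^sub>2) \<in> trans_rel I \<Longrightarrow>
        C\<^sub>1 = C\<^sub>2 \<and> s\<^sub>1 = s\<^sub>2"
    and active_exists:
      "\<exists>active :: 's \<Rightarrow> 'c set.
        (\<forall>s\<in>states I. active s \<subseteq> clocks I) \<and>
        active (init_state I) \<subseteq> init_clocks I \<and>
        (\<forall>s\<in>states I. enabling I s \<subseteq> active s) \<and>
        (\<forall>s\<in>states I. stable I s \<longrightarrow> active s = enabling I s) \<and>
        (\<forall>t C a C' s. (t, C, a, C', s) \<in> trans_rel I \<longrightarrow> active s \<subseteq> (active t - C) \<union> C')"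

definition uen :: "('s, 'a, 'c) iosa_struct \<Rightarrow> 's \<Rightarrow> 'a set" where
  "uen I s = {a \<in> urgent I. \<exists>s'. step I s a s'}"

definition potentially_reachable :: "('s, 'a, 'c) iosa_struct \<Rightarrow> 's \<Rightarrow> bool" where
  "potentially_reachable I s \<longleftrightarrow>
    (\<exists>(m::nat) (\<sigma> :: nat \<Rightarrow> 's) (\<alpha> :: nat \<Rightarrow> 'a).
      \<sigma> 0 = init_state I \<and> \<sigma> m = s \<and>
      (\<forall>i<m. step I (\<sigma> i) (\<alpha> i) (\<sigma> (Suc i))) \<and>
      (\<forall>i<m. (\<exists>c\<in>urgent_outputs I. \<exists>s'. step I (\<sigma> i) c s') \<longrightarrow> \<alpha> i \<in> urgent I))"

definition initial_set :: "('s, 'a, 'c) iosa_struct \<Rightarrow> 'a set \<Rightarrow> bool" where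
  "initial_set I B \<longleftrightarrow> B \<subseteq> urgent_outputs I \<and> B \<subseteq> uen I (init_state I)"

definition spontaneously_enabled_by ::
  "('s, 'a, 'c) iosa_struct \<Rightarrow> 'a set \<Rightarrow> 'a \<Rightarrow> bool" where
  "spontaneously_enabled_by I B a \<longleftrightarrow>
    B \<subseteq> urgent_outputs I \<and> a \<in> actions I - urgent I \<and>
    (B = {} \<or>
     (\<exists>s s'. potentially_reachable I s \<and> potentially_reachable I s' \<and>
       stable I s \<and> step I s a s' \<and> B \<subseteq> uen I s'))"

definition triggers :: "('s, 'a, 'c) iosa_struct \<Rightarrow> 'a \<Rightarrow> 'a \<Rightarrow> bool" where
  "triggers I a b \<longleftrightarrow>
    a \<in> urgent I \<and> b \<in> urgent_outputs I \<and>
    (\<exists>s\<^sub>1 s\<^sub>2 s\<^sub>3. potentially_reachable I s\<^sub>1 \<and> potentially_reachable I s\<^sub>2 \<and>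
       potentially_reachable I s\<^sub>3 \<and> step I s\<^sub>1 a s\<^sub>2 \<and> step I s\<^sub>2 b s\<^sub>3 \<and>
       (a \<noteq> b \<longrightarrow> b \<notin> uen I s\<^sub>1))"

end

theory Submission
  imports Defs
begin

text \<open>Follow an admissible path to a state enabling \<open>b\<close> and look at where
  \<open>b\<close> first becomes enabled. If this is the initial state, \<open>{b}\<close> is
  initial. Otherwise some step from \<open>s\<close> to \<open>s'\<close> by an action
  \<open>a\<close> makes \<open>b\<close> newly enabled. If \<open>a\<close> is urgent, it triggers
  \<open>b\<close>. If not, the priority of urgent outputs along the path forces \<open>s\<close> to
  be stable, so \<open>a\<close> spontaneously enables \<open>{b}\<close>. The search for this step
  is an induction over reachability, \<open>potentially_reachable_induct\<close>.\<close>

lemma potentially_reachable_init: "potentially_reachable I (init_state I)"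
  unfolding potentially_reachable_def
  by (rule exI[of _ 0], rule exI[of _ "\<lambda>_. init_state I"]) simp

lemma potentially_reachable_step:
  assumes "potentially_reachable I s" "step I s a s'"
    and "\<exists>c\<in>urgent_outputs I. \<exists>t. step I s c t \<Longrightarrow> a \<in> urgent I"
  shows "potentially_reachable I s'"
proof -
  obtain m \<sigma> \<alpha> where path: "\<sigma> 0 = init_state I" "\<sigma> m = s"
      "\<And>i. i < m \<Longrightarrow> step I (\<sigma> i) (\<alpha> i) (\<sigma> (Suc i))"
      "\<And>i. i < m \<Longrightarrow> \<exists>c\<in>urgent_outputs I. \<exists>t. step I (\<sigma> i) c t \<Longrightarrow> \<alpha> i \<in> urgent I"
    using assms(1) unfolding potentially_reachable_def by blast
  show ?thesis
    unfolding potentially_reachable_def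
    \<comment> \<open>The old path constrains states only up to index \<open>m\<close> and actions
      only below \<open>m\<close>, so both updates overwrite arbitrary values.\<close>
    by (rule exI[of _ "Suc m"], rule exI[of _ "\<sigma>(Suc m := s')"], rule exI[of _ "\<alpha>(m := a)"])
      (use path assms(2,3) in \<open>simp add: less_Suc_eq all_conj_distrib\<close>)
qed

text \<open>Every prefix of an admissible path is admissible, so induction along the path can also
  supply reachability of the source and the priority condition at each step.\<close>

lemma potentially_reachable_induct [consumes 1, case_names init step]:
  assumes "potentially_reachable I s"
    and init: "P (init_state I)"
    and step: "\<And>s a s'. potentially_reachable I s \<Longrightarrow> P s \<Longrightarrow> step I s a s' \<Longrightarrow>
      (\<exists>c\<in>urgent_outputs I. \<exists>t. step I s c t \<Longrightarrow> a \<in> urgent I) \<Longrightarrow> P s'"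
  shows "P s"
proof -
  obtain m \<sigma> \<alpha> where path: "\<sigma> 0 = init_state I" "\<sigma> m = s"
      "\<And>i. i < m \<Longrightarrow> step I (\<sigma> i) (\<alpha> i) (\<sigma> (Suc i))"
      "\<And>i. i < m \<Longrightarrow> \<exists>c\<in>urgent_outputs I. \<exists>t. step I (\<sigma> i) c t \<Longrightarrow> \<alpha> i \<in> urgent I"
    using assms(1) unfolding potentially_reachable_def by blast
  have "potentially_reachable I (\<sigma> i) \<and> P (\<sigma> i)" if "i \<le> m" for i
    using that
  proof (induction i)
    case 0
    then show ?case using path(1) init potentially_reachable_init by simp
  next
    case (Suc i)
    then have IH: "potentially_reachable I (\<sigma> i)" "P (\<sigma> i)" and "i < m" by auto
    note stp = path(3,4)[OF \<open>i < m\<close>]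
    show ?case
      using potentially_reachable_step[OF IH(1) stp] step[OF IH stp] by blast
  qed
  then show ?thesis using path(2) by blast
qed

theorem theorem4:
  fixes I :: "('s, 'a, 'c) iosa_struct" and b :: 'a
  assumes "IOSA I"
    and "b \<in> urgent I \<inter> outputs I"
    and "\<exists>s. potentially_reachable I s \<and> b \<in> uen I s"
  shows "(\<exists>B. b \<in> B \<and>
            (initial_set I B \<or> (\<exists>a \<in> actions I - urgent I. spontaneously_enabled_by I B a))) \<or>
         (\<exists>a \<in> urgent I. triggers I a b)"
    (is ?goal)
proof -
  have b: "b \<in> urgent_outputs I" "b \<in> urgent I"
    using assms(2) by (auto simp: urgent_outputs_def)
  obtain s where "potentially_reachable I s" "b \<in> uen I s"
    using assms(3) by blast
  then show ?goal
  proof (induction rule: potentially_reachable_induct)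
    case init
    then have "initial_set I {b}" using b by (simp add: initial_set_def)
    then show ?case by blast
  next
    case (step s a s')
    show ?case
    proof (cases "b \<in> uen I s")
      case True
      \<comment> \<open>The goal does not mention the state, so the earlier occurrence of
        \<open>b\<close> settles it.\<close>
      then show ?thesis by (rule step.IH)
    next
      case new: False
      have reach: "potentially_reachable I s'"
        using step.hyps by (rule potentially_reachable_step)
      show ?thesis
      proof (cases "a \<in> urgent I")
        case True
        obtain t where t: "step I s' b t"
          using \<open>b \<in> uen I s'\<close> by (auto simp: uen_def)
        \<comment> \<open>Urgency of \<open>b\<close> meets the priority condition whatever is
          enabled in \<open>s'\<close>.\<close>
        have "potentially_reachable I t"
          using reach t b(2) by (rule potentially_reachable_step)
        then have "triggers I a b"
          unfolding triggers_def using True b(1) step.hyps(1,2) reach t new by blast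
        then show ?thesis using True by blast
      next
        case False
        \<comment> \<open>Contrapositive of the priority condition: a non-urgent step is allowed
          only where no urgent output is enabled, under any guard.\<close>
        then have "stable I s"
          using step.hyps(3) unfolding stable_def step_def by blast
        moreover have "a \<in> actions I - urgent I"
          using False step.hyps(2) IOSA.trans_rel_subset[OF assms(1)]
          unfolding step_def by blast
        ultimately have "spontaneously_enabled_by I {b} a"
          unfolding spontaneously_enabled_by_def
          using b(1) step.hyps(1,2) reach \<open>b \<in> uen I s'\<close> by blast
        then show ?thesis using \<open>a \<in> actions I - urgent I\<close> by blast
      qed
    qed
  qed
qed

end
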